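(* For any graph $G$, we have $$\sum_{v \in V(G)} 2^{-d(v)} - \frac{|E(G)|+7}{8} \;\leq\; u(G) \;\leq\; \sum_{v \in V(G)} 2^{-d(v)},$$ where $d(v)$ denotes the degree of the vertex $v$. Equivalently, $$\sum_{i \ge 0} 2^{-i} d_i - \frac{|E(G)|+7}{8} \;\leq\; u(G) \;\leq\; \sum_{i \ge 0} 2^{-i} d_i,$$ where $d_{i}$ denotes the number of vertices of $G$ with degree exactly $i$.
   Context: Graphs are finite and simple. The Toucher-Isolator game on a graph $G=(V(G),E(G))$: two players, Toucher and Isolator, alternately claim previously unclaimed edges of $G$, one edge per move, with Toucher making the first move, until all edges are claimed. A vertex is touched if it is incident to at least one edge claimed by Toucher, and untouched otherwise (i.e. all of its incident edges have been claimed by Isolator; in particular a vertex of degree $0$ is untouched). Toucher aims to minimise, and Isolator to maximise, the number of untouched vertices at the end of the game. $u(G)$ denotes the number of untouched vertices at the end of the game when both players play optimally (the minimax value of this game). *)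

theory Defs
  imports Complex_Main
begin

definition finite_simple_graph :: "'a set \<Rightarrow> 'a set set \<Rightarrow> bool" where
  "finite_simple_graph V E \<longleftrightarrow> finite V \<and> (\<forall>e\<in>E. e \<subseteq> V \<and> card e = 2)"

definition degree :: "'a set set \<Rightarrow> 'a \<Rightarrow> nat" where
  "degree E v = card {e \<in> E. v \<in> e}"

definition num_of_degree :: "'a set \<Rightarrow> 'a set set \<Rightarrow> nat \<Rightarrow> nat" where
  "num_of_degree V E i = card {v \<in> V. degree E v = i}"

definition untouched :: "'a set \<Rightarrow> 'a set set \<Rightarrow> 'a set" where
  "untouched V T = {v \<in> V. \<not> (\<exists>e\<in>T. v \<in> e)}"

text \<open>
  A position of the game is given by the set \<open>T\<close> of edges claimed by Toucher so far and the set
  \<open>U\<close> of edges not yet claimed; all other edges belong to Isolator. The minimax value of a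
  position, with Toucher respectively Isolator to move, is defined by backward induction.
  Finiteness of \<open>U\<close> is tested only to make the recursion terminate; it always holds in a
  finite graph.
\<close>

context
  notes image_cong [fundef_cong]
begin

function value_toucher :: "'a set \<Rightarrow> 'a set set \<Rightarrow> 'a set set \<Rightarrow> nat"
  and value_isolator :: "'a set \<Rightarrow> 'a set set \<Rightarrow> 'a set set \<Rightarrow> nat" where
  "value_toucher V T U =
     (if finite U \<and> U \<noteq> {}
      then Min ((\<lambda>e. value_isolator V (insert e T) (U - {e})) ` U)
      else card (untouched V T))"
| "value_isolator V T U =
     (if finite U \<and> U \<noteq> {}
      then Max ((\<lambda>e. value_toucher V T (U - {e})) ` U)
      else card (untouched V T))"
  by pat_completeness auto

termination
  by (relation "measure (case_sum (\<lambda>(V, T, U). card U) (\<lambda>(V, T, U). card U))")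
     (auto simp: card_gt_0_iff)

end

declare value_toucher.simps [simp del] value_isolator.simps [simp del]

definition game_value :: "'a set \<Rightarrow> 'a set set \<Rightarrow> nat" where
  "game_value V E = value_toucher V {} E"

end

theory Submission
  imports Defs
begin

text \<open>
  If the unclaimed edges were handed out by independent fair coin flips, a vertex that is not yet
  touched and has \<open>k\<close> unclaimed edges would end up untouched with probability \<open>1 / 2 ^ k\<close>.
  The expected number of untouched vertices is therefore a potential for the game; at the start it
  is \<open>\<Sum>v\<in>V. 1 / 2 ^ degree E v\<close>, at the end it is the outcome. A move on an edge \<open>e\<close> changes it by
  the danger of \<open>e\<close>, the sum of the two survival probabilities at its ends: downwards if Toucher
  moves, upwards if Isolator does. Both bounds come from always claiming an edge of maximal danger.

  For Toucher this suffices as it stands: no danger increases by Toucher's move, so Isolator's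
  reply cannot win back more than was lost, and the potential does not grow over a round
  (\<open>value_toucher_le_potential\<close>).

  For Isolator, consider rounds in which Isolator moves first, claiming \<open>f\<close>. This doubles the
  survival probability at the ends of \<open>f\<close>. Toucher's reply \<open>e\<close> meets \<open>f\<close> in at most one
  vertex, and that vertex had at least two unclaimed edges, so the danger of \<open>e\<close>, at most that of
  \<open>f\<close> before, rose by at most \<open>1/4\<close>. Hence the potential drops by at most \<open>1/4\<close> over two
  moves, that is, by \<open>1/8\<close> per edge (\<open>value_isolator_ge_potential\<close>). Toucher's opening move precedes these rounds and costs at most
  \<open>1/2 + 1/2\<close>, and \<open>1 + (card E - 1) / 8 = (card E + 7) / 8\<close>.
\<close>

definition survival_prob :: "'a set set \<Rightarrow> 'a set set \<Rightarrow> 'a \<Rightarrow> real" where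
  "survival_prob T U v = (if \<exists>e\<in>T. v \<in> e then 0 else 1 / 2 ^ degree U v)"

definition potential :: "'a set \<Rightarrow> 'a set set \<Rightarrow> 'a set set \<Rightarrow> real" where
  "potential V T U = (\<Sum>v\<in>V. survival_prob T U v)"

definition danger :: "'a set set \<Rightarrow> 'a set set \<Rightarrow> 'a set \<Rightarrow> real" where
  "danger T U e = (\<Sum>v\<in>e. survival_prob T U v)"

lemma finite_simple_graphD:
  assumes "finite_simple_graph V E"
  shows "finite V" "finite E" "\<And>e. e \<in> E \<Longrightarrow> e \<subseteq> V" "\<And>e. e \<in> E \<Longrightarrow> finite e"
    "\<And>e. e \<in> E \<Longrightarrow> card e = 2" "finite_simple_graph V (E - {e})"
proof -
  show fV: "finite V" and sub: "\<And>e. e \<in> E \<Longrightarrow> e \<subseteq> V" and "\<And>e. e \<in> E \<Longrightarrow> card e = 2"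
    and "finite_simple_graph V (E - {e})"
    using assms by (auto simp: finite_simple_graph_def)
  show "finite E"
    by (rule finite_subset[of _ "Pow V"]) (use fV sub in auto)
  show "\<And>e. e \<in> E \<Longrightarrow> finite e"
    using fV sub finite_subset by blast
qed

lemma survival_prob_nonneg: "0 \<le> survival_prob T U v"
  by (simp add: survival_prob_def)

lemma danger_nonneg: "0 \<le> danger T U e"
  by (simp add: danger_def survival_prob_nonneg sum_nonneg)

lemma degree_diff_edge:
  assumes "finite U" "e \<in> U"
  shows "degree U v = (if v \<in> e then Suc (degree (U - {e}) v) else degree (U - {e}) v)"
proof (cases "v \<in> e")
  case True
  then have "{d \<in> U. v \<in> d} = insert e {d \<in> U - {e}. v \<in> d}"
    using assms by auto
  then show ?thesis
    using True assms(1) by (simp add: degree_def)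
next
  case False
  then have "{d \<in> U. v \<in> d} = {d \<in> U - {e}. v \<in> d}"
    by auto
  then show ?thesis
    using False by (simp add: degree_def)
qed

lemma survival_prob_toucher_move:
  assumes "finite U" "e \<in> U"
  shows "survival_prob (insert e T) (U - {e}) v = (if v \<in> e then 0 else survival_prob T U v)"
  using degree_diff_edge[OF assms, of v] by (auto simp: survival_prob_def)

lemma survival_prob_isolator_move:
  assumes "finite U" "e \<in> U"
  shows "survival_prob T (U - {e}) v = survival_prob T U v + (if v \<in> e then survival_prob T U v else 0)"
  using degree_diff_edge[OF assms, of v] by (auto simp: survival_prob_def field_simps)

lemma potential_isolator_move:
  assumes "finite_simple_graph V U" "e \<in> U"
  shows "potential V T (U - {e}) = potential V T U + danger T U e"
proof -
  have "V \<inter> e = e"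
    using finite_simple_graphD(3)[OF assms] by blast
  then have "(\<Sum>v\<in>V. if v \<in> e then survival_prob T U v else 0) = danger T U e"
    using finite_simple_graphD(1)[OF assms(1)]
    by (simp add: danger_def sum.inter_restrict[symmetric])
  then show ?thesis
    using survival_prob_isolator_move[OF finite_simple_graphD(2)[OF assms(1)] assms(2), of T]
    by (simp add: potential_def sum.distrib)
qed

lemma potential_toucher_move:
  assumes "finite_simple_graph V U" "e \<in> U"
  shows "potential V (insert e T) (U - {e}) = potential V T U - danger T U e"
proof -
  have "potential V (insert e T) (U - {e}) = (\<Sum>v\<in>V - e. survival_prob T U v)"
    unfolding potential_def
      survival_prob_toucher_move[OF finite_simple_graphD(2)[OF assms(1)] assms(2)]
    using finite_simple_graphD(1)[OF assms(1)]
    by (intro sum.mono_neutral_cong_right) auto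
  also have "\<dots> = potential V T U - danger T U e"
    unfolding potential_def danger_def
    using finite_simple_graphD(1,3)[OF assms(1)] assms(2) by (intro sum_diff) auto
  finally show ?thesis .
qed

lemma danger_toucher_move_le:
  assumes "finite U" "e \<in> U"
  shows "danger (insert e T) (U - {e}) f \<le> danger T U f"
  unfolding danger_def survival_prob_toucher_move[OF assms]
  by (intro sum_mono) (simp add: survival_prob_nonneg)

text \<open>
  Both ends of an unclaimed edge have at least one unclaimed edge, hence survive with probability
  at most \<open>1/2\<close>. This bounds the cost of Toucher's opening move.
\<close>

lemma danger_le_1:
  assumes "finite_simple_graph V U" "e \<in> U"
  shows "danger T U e \<le> 1"
proof -
  have "survival_prob T U v \<le> 1 / 2" if "v \<in> e" for v
    using degree_diff_edge[OF finite_simple_graphD(2)[OF assms(1)] assms(2), of v] that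
    by (simp add: survival_prob_def divide_le_eq)
  then have "danger T U e \<le> of_nat (card e) * (1 / 2)"
    unfolding danger_def by (intro sum_bounded_above) auto
  then show ?thesis
    using finite_simple_graphD(5)[OF assms] by simp
qed

text \<open>
  Only a vertex common to \<open>e\<close> and \<open>f\<close> contributes to the increase. There is at most one, since
  the graph is simple, and it lies on the two unclaimed edges \<open>e\<close> and \<open>f\<close>, so its survival
  probability was at most \<open>1/4\<close>.
\<close>

lemma danger_isolator_move_le:
  assumes G: "finite_simple_graph V U" and f: "f \<in> U" and e: "e \<in> U" and "e \<noteq> f"
  shows "danger T (U - {f}) e \<le> danger T U e + 1 / 4"
proof -
  note fin = finite_simple_graphD(2)[OF G]
  have "finite e" "finite f" "card e = 2" "card f = 2"
    using finite_simple_graphD(4,5)[OF G] e f by auto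
  have "card (e \<inter> f) \<noteq> 2"
    using \<open>e \<noteq> f\<close> \<open>finite e\<close> \<open>finite f\<close> \<open>card e = 2\<close> \<open>card f = 2\<close>
    by (metis card_subset_eq inf_le1 inf_le2)
  moreover have "card (e \<inter> f) \<le> 2"
    using card_mono[of e "e \<inter> f"] \<open>finite e\<close> \<open>card e = 2\<close> by simp
  ultimately have card: "card (e \<inter> f) \<le> 1"
    by simp
  have "survival_prob T U v \<le> 1 / 4" if "v \<in> e \<inter> f" for v
  proof -
    have "degree U v = Suc (Suc (degree (U - {f} - {e}) v))"
      using degree_diff_edge[OF fin f, of v] degree_diff_edge[of "U - {f}" e v] fin e that \<open>e \<noteq> f\<close>
      by simp
    then show ?thesis
      by (simp add: survival_prob_def divide_le_eq)
  qed
  then have "(\<Sum>v\<in>e \<inter> f. survival_prob T U v) \<le> of_nat (card (e \<inter> f)) * (1 / 4)"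
    by (intro sum_bounded_above) auto
  also have "\<dots> \<le> 1 / 4"
    using card by simp
  finally have "(\<Sum>v\<in>e \<inter> f. survival_prob T U v) \<le> 1 / 4" .
  then show ?thesis
    using \<open>finite e\<close> unfolding danger_def survival_prob_isolator_move[OF fin f]
    by (simp add: sum.distrib sum.inter_restrict[symmetric])
qed

lemma potential_no_edges:
  assumes "finite V"
  shows "potential V T {} = real (card (untouched V T))"
  using assms
  by (simp add: potential_def survival_prob_def degree_def untouched_def sum.If_cases Int_def)

lemma value_no_edges:
  "value_toucher V T {} = card (untouched V T)" "value_isolator V T {} = card (untouched V T)"
  by (simp_all add: value_toucher.simps value_isolator.simps)

lemma value_toucher_le:
  assumes "finite U" "e \<in> U"
  shows "value_toucher V T U \<le> value_isolator V (insert e T) (U - {e})"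
  using assms by (auto simp: value_toucher.simps[of V T U])

lemma value_isolator_ge:
  assumes "finite U" "e \<in> U"
  shows "value_toucher V T (U - {e}) \<le> value_isolator V T U"
  using assms by (auto simp: value_isolator.simps[of V T U])

lemma value_toucher_attained:
  assumes "finite U" "U \<noteq> {}"
  obtains e where "e \<in> U" "value_toucher V T U = value_isolator V (insert e T) (U - {e})"
proof -
  have "value_toucher V T U \<in> (\<lambda>e. value_isolator V (insert e T) (U - {e})) ` U"
    using assms by (simp add: value_toucher.simps[of V T U])
  then show thesis
    using that by auto
qed

lemma value_isolator_attained:
  assumes "finite U" "U \<noteq> {}"
  obtains e where "e \<in> U" "value_isolator V T U = value_toucher V T (U - {e})"
proof -
  have "value_isolator V T U \<in> (\<lambda>e. value_toucher V T (U - {e})) ` U"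
    using assms by (simp add: value_isolator.simps[of V T U])
  then show thesis
    using that by auto
qed

lemma ex_max_danger:
  assumes "finite U" "U \<noteq> {}"
  obtains e where "e \<in> U" "\<And>f. f \<in> U \<Longrightarrow> danger T U f \<le> danger T U e"
proof -
  have "Max (danger T U ` U) \<in> danger T U ` U"
    using assms by simp
  then obtain e where "e \<in> U" "danger T U e = Max (danger T U ` U)"
    by auto
  then show thesis
    using that assms(1) by simp
qed

text \<open>
  Toucher claims an edge \<open>e\<close> of maximal danger. Isolator's reply gains its danger after that move,
  which is at most its danger before, which is at most the danger of \<open>e\<close>.
\<close>

lemma value_toucher_le_potential:
  assumes "finite_simple_graph V U"
  shows "real (value_toucher V T U) \<le> potential V T U"
  using assms
proof (induction "card U" arbitrary: T U rule: less_induct)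
  case less
  note G = less.prems
  note fin = finite_simple_graphD(2)[OF G]
  show ?case
  proof (cases "U = {}")
    case True
    then show ?thesis
      using potential_no_edges[of V T] finite_simple_graphD(1)[OF G] by (simp add: value_no_edges)
  next
    case False
    obtain e where e: "e \<in> U" and max: "\<And>f. f \<in> U \<Longrightarrow> danger T U f \<le> danger T U e"
      using ex_max_danger[OF fin False] by blast
    let ?T = "insert e T" and ?U = "U - {e}"
    note G' = finite_simple_graphD(6)[OF G, of e]
    note P = potential_toucher_move[OF G e, of T]
    have "real (value_isolator V ?T ?U) \<le> potential V T U"
    proof (cases "?U = {}")
      case True
      then show ?thesis
        using P danger_nonneg[of T U e] potential_no_edges[of V ?T] finite_simple_graphD(1)[OF G]
        by (simp only: True value_no_edges)
    next
      case False
      obtain f where f: "f \<in> ?U" and "value_isolator V ?T ?U = value_toucher V ?T (?U - {f})"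
        using value_isolator_attained[of ?U V ?T] fin False by auto
      moreover have "real (value_toucher V ?T (?U - {f})) \<le> potential V ?T (?U - {f})"
      proof (rule less.hyps)
        show "card (?U - {f}) < card U"
          using fin e f by (intro psubset_card_mono) auto
      qed (rule finite_simple_graphD(6)[OF G'])
      moreover have "danger ?T ?U f \<le> danger T U e"
        using danger_toucher_move_le[OF fin e, of T f] max[of f] f by simp
      ultimately show ?thesis
        using P potential_isolator_move[OF G' f, of ?T] by simp
    qed
    then show ?thesis
      using value_toucher_le[OF fin e, of V T] by linarith
  qed
qed

text \<open>
  Isolator claims an edge of maximal danger. If it is the last one, the potential does not fall;
  otherwise Toucher's reply leaves a net loss of at most \<open>1/4\<close>, and two edges are used up.
\<close>

lemma value_isolator_ge_potential:
  assumes "finite_simple_graph V U"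
  shows "potential V T U - real (card U) / 8 \<le> real (value_isolator V T U)"
  using assms
proof (induction "card U" arbitrary: T U rule: less_induct)
  case less
  note G = less.prems
  note fin = finite_simple_graphD(2)[OF G]
  show ?case
  proof (cases "U = {}")
    case True
    then show ?thesis
      using potential_no_edges[of V T] finite_simple_graphD(1)[OF G] by (simp add: value_no_edges)
  next
    case False
    obtain f where f: "f \<in> U" and max: "\<And>e. e \<in> U \<Longrightarrow> danger T U e \<le> danger T U f"
      using ex_max_danger[OF fin False] by blast
    let ?U = "U - {f}"
    note G' = finite_simple_graphD(6)[OF G, of f]
    note P = potential_isolator_move[OF G f, of T]
    have "potential V T U - real (card U) / 8 \<le> real (value_toucher V T ?U)"
    proof (cases "?U = {}")
      case True
      then have "potential V T U \<le> real (value_toucher V T ?U)"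
        using P danger_nonneg[of T U f] potential_no_edges[of V T] finite_simple_graphD(1)[OF G]
        by (simp only: True value_no_edges)
      then show ?thesis
        by (simp add: algebra_simps add_increasing2)
    next
      case False
      obtain e where e: "e \<in> ?U" and v: "value_toucher V T ?U = value_isolator V (insert e T) (?U - {e})"
        using value_toucher_attained[of ?U V T] fin False by auto
      have "card U = card (?U - {e}) + 2"
        using card_Suc_Diff1[OF fin f] card_Suc_Diff1[of ?U e] fin e by simp
      moreover have "potential V (insert e T) (?U - {e}) - real (card (?U - {e})) / 8
          \<le> real (value_isolator V (insert e T) (?U - {e}))"
      proof (rule less.hyps)
        show "card (?U - {e}) < card U"
          using fin f e by (intro psubset_card_mono) auto
      qed (rule finite_simple_graphD(6)[OF G'])
      moreover have "danger T ?U e \<le> danger T U f + 1 / 4"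
        using danger_isolator_move_le[OF G f, of e T] max[of e] e by simp
      ultimately show ?thesis
        using P v potential_toucher_move[OF G' e, of T]
        by (simp add: add_divide_distrib)
    qed
    then show ?thesis
      using value_isolator_ge[OF fin f, of V T] by linarith
  qed
qed

lemma potential_start: "potential V {} E = (\<Sum>v\<in>V. 1 / 2 ^ degree E v)"
  by (simp add: potential_def survival_prob_def)

lemma suminf_num_of_degree:
  fixes g :: "nat \<Rightarrow> real"
  assumes "finite V"
  shows "(\<Sum>i. g i * real (num_of_degree V E i)) = (\<Sum>v\<in>V. g (degree E v))"
proof -
  have "(\<Sum>i. g i * real (num_of_degree V E i))
      = (\<Sum>i\<in>degree E ` V. g i * real (num_of_degree V E i))"
  proof (rule suminf_finite)
    show "g i * real (num_of_degree V E i) = 0" if "i \<notin> degree E ` V" for i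
    proof -
      have "{v \<in> V. degree E v = i} = {}"
        using that by auto
      then show ?thesis
        by (simp only: num_of_degree_def card.empty of_nat_0 mult_zero_right)
    qed
  qed (use assms in simp)
  also have "\<dots> = (\<Sum>i\<in>degree E ` V. \<Sum>v | v \<in> V \<and> degree E v = i. g (degree E v))"
    by (simp add: num_of_degree_def mult.commute)
  also have "\<dots> = (\<Sum>v\<in>V. g (degree E v))"
    using sum.image_gen[OF assms, of "\<lambda>v. g (degree E v)" "degree E"] by simp
  finally show ?thesis .
qed

lemma game_value_ge:
  assumes "finite_simple_graph V E"
  shows "potential V {} E - (real (card E) + 7) / 8 \<le> real (game_value V E)"
proof (cases "E = {}")
  case True
  then show ?thesis
    using potential_no_edges[of V "{}"] finite_simple_graphD(1)[OF assms]
    by (simp add: game_value_def value_no_edges)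
next
  case False
  note fin = finite_simple_graphD(2)[OF assms]
  obtain e where e: "e \<in> E" "value_toucher V {} E = value_isolator V {e} (E - {e})"
    using value_toucher_attained[OF fin False] by blast
  have "real (card E) = real (card (E - {e})) + 1"
    using card_Suc_Diff1[OF fin e(1)] by simp
  then show ?thesis
    using value_isolator_ge_potential[OF finite_simple_graphD(6)[OF assms], of "{e}" e]
      potential_toucher_move[OF assms e(1), of "{}"] danger_le_1[OF assms e(1), of "{}"] e(2)
    by (simp add: game_value_def field_simps)
qed

theorem theorem1p2:
  fixes V :: "'a set" and E :: "'a set set"
  assumes "finite_simple_graph V E"
  shows "((\<Sum>v\<in>V. 1 / 2 ^ degree E v) - (real (card E) + 7) / 8 \<le> real (game_value V E)
          \<and> real (game_value V E) \<le> (\<Sum>v\<in>V. 1 / 2 ^ degree E v))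
       \<and> ((\<Sum>i. 1 / 2 ^ i * real (num_of_degree V E i)) - (real (card E) + 7) / 8
            \<le> real (game_value V E)
          \<and> real (game_value V E) \<le> (\<Sum>i. 1 / 2 ^ i * real (num_of_degree V E i)))"
  using game_value_ge[OF assms] value_toucher_le_potential[OF assms, of "{}"]
    suminf_num_of_degree[OF finite_simple_graphD(1)[OF assms], of "\<lambda>i. 1 / 2 ^ i" E]
  by (simp add: potential_start game_value_def)

end
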